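(* Let $m \ge 3$ be odd and $n = 3^m-1$. Then the dual code $\mathcal{C}_{(2,3,m)}^\perp$ has parameters $[n,k,d]$ with $d \ge \frac{3^{(m-1)/2}+15}{2}$ if $m \equiv 1 \pmod 4$ and $d \ge \frac{3^{(m-1)/2}+13}{2}$ if $m \equiv 3 \pmod 4$, and $k = \frac{n-2}{2}$ if $m \equiv 1 \pmod 4$ and $k = \frac{n}{2}$ if $m \equiv 3 \pmod 4$.
   Context: Let $m \ge 2$ be an integer, $n = 3^m-1$, and let $\alpha$ be a primitive element of $\mathbb{F}_{3^m}$. For an integer $0 \le j \le n-1$ with $3$-adic expansion $j = \sum_{t=0}^{m-1} j_t 3^t$, $j_t \in \{0,1,2\}$, let $w_3(j) = \sum_{t=0}^{m-1} j_t$. For distinct $i_1, i_2 \in \{0,1,2,3\}$ let $T_{(i_1,i_2,m)} = \{1 \le j \le n-1 : w_3(j) \equiv i_1 \text{ or } i_2 \pmod 4\}$ and $g_{(i_1,i_2,m)}(x) = \prod_{j \in T_{(i_1,i_2,m)}} (x - \alpha^j) \in \mathbb{F}_3[x]$. $\mathcal{C}_{(i_1,i_2,m)}$ denotes the ternary cyclic code of length $n$ with generator polynomial $g_{(i_1,i_2,m)}(x)$, and $\mathcal{C}^\perp$ denotes the dual code with respect to the standard inner product on $\mathbb{F}_3^n$. Parameters $[n,k,d]$ mean length, dimension over $\mathbb{F}_3$, and minimum Hamming distance. *)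

theory Defs
  imports "HOL-Computational_Algebra.Polynomial"
begin

fun w3 :: "nat \<Rightarrow> nat" where
  "w3 j = (if j = 0 then 0 else j mod 3 + w3 (j div 3))"

text \<open>The prime field F_3 inside a field 'a of characteristic 3.\<close>
definition F3 :: "'a::field set" where
  "F3 = {0, 1, 2}"

definition primitive_elem :: "'a::field \<Rightarrow> bool" where
  "primitive_elem \<alpha> \<longleftrightarrow> \<alpha> \<noteq> 0 \<and> (\<forall>x. x \<noteq> 0 \<longrightarrow> (\<exists>j::nat. x = \<alpha> ^ j))"

definition T_set :: "nat \<Rightarrow> nat \<Rightarrow> nat \<Rightarrow> nat set" where
  "T_set i1 i2 m = {j. 1 \<le> j \<and> j \<le> 3 ^ m - 2 \<and> (w3 j mod 4 = i1 \<or> w3 j mod 4 = i2)}"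

definition gen_poly :: "nat \<Rightarrow> nat \<Rightarrow> nat \<Rightarrow> 'a::field \<Rightarrow> 'a poly" where
  "gen_poly i1 i2 m \<alpha> = (\<Prod>j\<in>T_set i1 i2 m. [:- (\<alpha> ^ j), 1:])"

text \<open>Words of length n over F_3 (embedded in 'a); word c corresponds to the
  polynomial c_0 + c_1 x + ... + c_{n-1} x^{n-1}.\<close>
definition words :: "nat \<Rightarrow> 'a::field list set" where
  "words n = {c. length c = n \<and> set c \<subseteq> F3}"

definition cyclic_code :: "nat \<Rightarrow> 'a::field poly \<Rightarrow> 'a list set" where
  "cyclic_code n g = {c \<in> words n. g dvd Poly c}"

definition code_C :: "nat \<Rightarrow> nat \<Rightarrow> nat \<Rightarrow> 'a::field \<Rightarrow> 'a list set" where
  "code_C i1 i2 m \<alpha> = cyclic_code (3 ^ m - 1) (gen_poly i1 i2 m \<alpha>)"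

definition dual_code :: "nat \<Rightarrow> 'a::field list set \<Rightarrow> 'a list set" where
  "dual_code n C = {v \<in> words n. \<forall>c\<in>C. (\<Sum>i<n. c ! i * v ! i) = 0}"

definition hamming_dist :: "'a list \<Rightarrow> 'a list \<Rightarrow> nat" where
  "hamming_dist x y = card {i. i < length x \<and> x ! i \<noteq> y ! i}"

definition min_dist :: "'a list set \<Rightarrow> nat" where
  "min_dist C = Min {hamming_dist x y | x y. x \<in> C \<and> y \<in> C \<and> x \<noteq> y}"

definition code_dim :: "'a list set \<Rightarrow> nat" where
  "code_dim C = (THE k. card C = 3 ^ k)"

end

theory Submission
  imports Defs
begin

text \<open>
  Write \<open>m = 2 h + 1\<close> and \<open>n = 2 N\<close>. By duality via traces, a word \<open>c\<close> over the prime field lies in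
  the dual code iff \<open>\<Sum>\<^sub>i c\<^sub>i \<alpha>\<^bsup>ie\<^esup>\<close> vanishes for \<open>e = 0\<close> and for all \<open>e\<close> of ternary weight \<open>1\<close> or
  \<open>2\<close> modulo \<open>4\<close>. The dimension is thus the number of \<open>j\<close> of weight \<open>2\<close> or \<open>3\<close> modulo \<open>4\<close>.

  For the distance, fold \<open>c\<close> to the word \<open>c\<^sub>p + c\<^bsub>p+N\<^esub>\<close> of length \<open>N\<close>, which sees the even exponents.
  Since \<open>l (3\<^sup>k - 1)\<close> has weight \<open>2 k\<close> for all \<open>1 \<le> l \<le> 3\<^sup>k\<close>, the folded word has \<open>3\<^sup>h + 1\<close> zeros in
  arithmetic progression; it is also self-orthogonal, so its weight is a multiple of \<open>3\<close>. Unless it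
  is zero, \<open>c\<close> has weight at least \<open>3\<^sup>h + 3\<close>. If it is zero, the odd exponents
  \<open>3\<^bsup>2h\<^esup> + l (3\<^sup>k - 1)\<close> bound the weight of each half of \<open>c\<close>. The case \<open>m = 3\<close>, where these bounds are
  too weak, follows from the generalised Newton identities.
\<close>

section \<open>Ternary weights\<close>

declare w3.simps [simp del]

lemma w3_zero [simp]: "w3 0 = 0"
  by (subst w3.simps) simp

lemma w3_triple_add: "q < 3 \<Longrightarrow> w3 (3 * j + q) = q + w3 j"
  by (cases "3 * j + q = 0") (simp, subst w3.simps, simp)

lemma w3_one [simp]: "w3 1 = 1" "w3 (Suc 0) = 1"
  using w3_triple_add[of 1 0] by simp_all

lemma base3_cases:
  fixes j :: nat
  assumes "j < 3 ^ Suc k"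
  obtains i q where "j = 3 * i + q" "q < 3" "i < 3 ^ k"
proof
  show "j = 3 * (j div 3) + j mod 3" by simp
  show "j div 3 < 3 ^ k" using assms by (simp add: less_mult_imp_div_less)
qed simp

text \<open>No carry crosses position \<open>k\<close>, so the two digit strings are
  concatenated.\<close>

lemma w3_shift_add: "b < 3 ^ k \<Longrightarrow> w3 (a * 3 ^ k + b) = w3 a + w3 b"
proof (induction k arbitrary: b)
  case (Suc k)
  then obtain i q where b: "b = 3 * i + q" "q < 3" "i < 3 ^ k"
    by (elim base3_cases)
  have "a * 3 ^ Suc k + b = 3 * (a * 3 ^ k + i) + q"
    by (simp add: b)
  then have "w3 (a * 3 ^ Suc k + b) = q + w3 (a * 3 ^ k + i)"
    using b by (simp only: w3_triple_add)
  then show ?case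
    using Suc.IH[OF b(3)] b by (simp add: w3_triple_add)
qed simp

text \<open>Subtracting from \<open>3 ^ k - 1\<close> needs no borrow: each of the \<open>k\<close>
  digits \<open>q\<close> becomes \<open>2 - q\<close>.\<close>

lemma w3_complement: "j < 3 ^ k \<Longrightarrow> w3 (3 ^ k - 1 - j) + w3 j = 2 * k"
proof (induction k arbitrary: j)
  case (Suc k)
  then obtain i q where b: "j = 3 * i + q" "q < 3" "i < 3 ^ k"
    by (elim base3_cases)
  have "3 ^ Suc k - 1 - j = 3 * (3 ^ k - 1 - i) + (2 - q)"
    using b by simp
  then have "w3 (3 ^ Suc k - 1 - j) = (2 - q) + w3 (3 ^ k - 1 - i)"
    by (simp only: w3_triple_add)
  then show ?case
    using Suc.IH[OF b(3)] b by (simp add: w3_triple_add)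
qed simp

text \<open>Powers of 3 are odd, so digit sums preserve parity.\<close>

lemma even_w3_iff: "even (w3 j) \<longleftrightarrow> even j"
proof (induction j rule: less_induct)
  case (less j)
  show ?case
  proof (cases "j = 0")
    case False
    then have "even (w3 (j div 3)) \<longleftrightarrow> even (j div 3)"
      by (intro less) simp
    moreover have "w3 j = j mod 3 + w3 (j div 3)"
      using w3_triple_add[of "j mod 3" "j div 3"] by simp
    ultimately show ?thesis by presburger
  qed simp
qed

text \<open>With \<open>l = i + 1\<close> the product is \<open>i * 3 ^ h + (3 ^ h - 1 - i)\<close>:
  the block \<open>i\<close> followed by its digitwise complement.\<close>

lemma w3_mult_pred_power:
  assumes "1 \<le> l" "l \<le> 3 ^ h"
  shows "w3 (l * (3 ^ h - 1)) = 2 * h"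
proof -
  obtain i where i: "l = Suc i" "i < 3 ^ h" using assms by (cases l) auto
  have "Suc i * (3 ^ h - 1) = i * 3 ^ h + (3 ^ h - 1 - i)"
    using i by (simp add: algebra_simps diff_mult_distrib2)
  then show ?thesis
    using w3_shift_add[of "3 ^ h - 1 - i" h i] w3_complement[OF i(2)] i by simp
qed

section \<open>Counting exponents by ternary weight modulo 4\<close>

lemma sum_lessThan_triple:
  "(\<Sum>j<3 * k. g j) = (\<Sum>j<k. g (3 * j) + g (3 * j + 1) + g (3 * j + 2))"
  for g :: "nat \<Rightarrow> 'b::comm_monoid_add"
  by (induction k) (simp_all add: eval_nat_numeral algebra_simps)

text \<open>Since \<open>half_sign (w + 2) = - half_sign w\<close>, the outer terms cancel in a sum
  over the three values of a digit.\<close>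

definition half_sign :: "nat \<Rightarrow> int" where
  "half_sign w = (if w mod 4 = 2 \<or> w mod 4 = 3 then 1 else - 1)"

lemma half_sign_add3: "half_sign w + half_sign (w + 1) + half_sign (w + 2) = half_sign (w + 1)"
  unfolding half_sign_def by presburger

text \<open>Summing over the lowest digit turns the shift \<open>s\<close> into
  \<open>s + 1\<close>; the shift is there to carry the induction.\<close>

lemma sum_half_sign_w3: "(\<Sum>j<3 ^ k. half_sign (w3 j + s)) = half_sign (s + k)"
proof (induction k arbitrary: s)
  case (Suc k)
  have "(\<Sum>j<3 ^ Suc k. half_sign (w3 j + s)) =
     (\<Sum>j<3 ^ k. half_sign (w3 (3 * j + 0) + s) + half_sign (w3 (3 * j + 1) + s)
        + half_sign (w3 (3 * j + 2) + s))"
    unfolding power_Suc sum_lessThan_triple by simp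
  also have "\<dots> = (\<Sum>j<3 ^ k. half_sign (w3 j + Suc s))"
  proof (intro sum.cong refl)
    fix j
    show "half_sign (w3 (3 * j + 0) + s) + half_sign (w3 (3 * j + 1) + s)
        + half_sign (w3 (3 * j + 2) + s) = half_sign (w3 j + Suc s)"
      using half_sign_add3[of "w3 j + s"] w3_triple_add[of 0 j] w3_triple_add[of 1 j]
        w3_triple_add[of 2 j] by simp
  qed
  finally show ?case using Suc.IH[of "Suc s"] by simp
qed simp

lemma card_T_set_23:
  assumes "odd m"
  shows "int (2 * card (T_set 2 3 m)) = 3 ^ m + half_sign m - 2"
proof -
  let ?B = "{j. j < 3 ^ m \<and> (w3 j mod 4 = 2 \<or> w3 j mod 4 = 3)}"
  have fin: "finite ?B" by simp
  have "half_sign m = (\<Sum>j<3 ^ m. half_sign (w3 j))"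
    using sum_half_sign_w3[of 0 m] by simp
  also have "\<dots> = (\<Sum>j<3 ^ m. 2 * (if j \<in> ?B then 1 else 0) - 1)"
    by (intro sum.cong) (auto simp: half_sign_def)
  also have "\<dots> = 2 * int (card ?B) - 3 ^ m"
    by (simp add: sum_subtractf flip: sum_distrib_left sum.inter_filter)
  finally have B: "2 * int (card ?B) = 3 ^ m + half_sign m" by simp
  have "w3 (3 ^ m - 1) = 2 * m"
    using w3_complement[of 0 m] by simp
  \<comment> \<open>The exponent \<open>3 ^ m - 1\<close> has weight 2 modulo 4 for odd
    \<open>m\<close>: it is counted in \<open>?B\<close> but lies outside the range of
    \<open>T_set\<close>.\<close>
  then have top: "3 ^ m - 1 \<in> ?B"
    using assms by simp presburger
  have "T_set 2 3 m = ?B - {3 ^ m - 1}"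
  proof (rule set_eqI)
    fix j show "j \<in> T_set 2 3 m \<longleftrightarrow> j \<in> ?B - {3 ^ m - 1}"
      by (cases "j = 0") (auto simp: T_set_def)
  qed
  then have "card (T_set 2 3 m) = card ?B - 1" "card ?B > 0"
    using top fin by (auto simp: card_gt_0_iff)
  with B show ?thesis by linarith
qed

section \<open>Polynomials over the prime field\<close>

text \<open>As \<open>3 = 0\<close>, the polynomial \<open>x ^ 3 - x\<close> splits with roots 0, 1,
  2. In this form, closure of the prime field follows from additivity of cubing.\<close>

lemma F3_iff_cube:
  assumes "(3::'a::field) = 0"
  shows "(x::'a) \<in> F3 \<longleftrightarrow> x ^ 3 = x"
proof -
  have "x ^ 3 - x = x * (x - 1) * (x - 2) + 3 * (x ^ 2 - x)"
    by (simp add: algebra_simps power2_eq_square power3_eq_cube)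
  then have "x ^ 3 - x = x * (x - 1) * (x - 2)" by (simp add: assms)
  then have "x ^ 3 = x \<longleftrightarrow> x * (x - 1) * (x - 2) = 0"
    by (metis eq_iff_diff_eq_0)
  then show ?thesis by (auto simp: F3_def)
qed

lemma two_neq_0_char_3:
  assumes "(3::'a::field) = 0"
  shows "(2::'a) \<noteq> 0"
proof
  assume "(2::'a) = 0"
  moreover have "(3::'a) = 2 + 1" by simp
  ultimately show False using assms by simp
qed

lemma card_F3:
  assumes "(3::'a::field) = 0"
  shows "card (F3 :: 'a set) = 3"
  using two_neq_0_char_3[OF assms]
  by (auto simp: F3_def card_insert_if)
    (metis one_add_one add_cancel_right_right zero_neq_one)

lemma cube_add:
  assumes "(3::'a::field) = 0"
  shows "((x::'a) + y) ^ 3 = x ^ 3 + y ^ 3"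
proof -
  have "(x + y) ^ 3 = x ^ 3 + y ^ 3 + 3 * (x ^ 2 * y + x * y ^ 2)"
    by (simp add: algebra_simps power2_eq_square power3_eq_cube)
  then show ?thesis by (simp add: assms)
qed

lemma cube_sum:
  assumes "(3::'a::field) = 0"
  shows "(\<Sum>i\<in>A. (f i::'a)) ^ 3 = (\<Sum>i\<in>A. f i ^ 3)"
  by (induction A rule: infinite_finite_induct) (simp_all add: cube_add assms)

lemma sum_power_3_power:
  assumes "(3::'a::field) = 0"
  shows "(\<Sum>i\<in>A. (f i::'a)) ^ (3 ^ t) = (\<Sum>i\<in>A. f i ^ (3 ^ t))"
  by (induction t) (simp_all add: power_mult cube_sum assms mult.commute[of 3])

lemma F3_power_3_power:
  assumes "(3::'a::field) = 0" "(x::'a) \<in> F3"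
  shows "x ^ (3 ^ t) = x"
  using assms by (induction t) (simp_all add: power_mult F3_iff_cube mult.commute[of 3])

lemma F3_diff:
  assumes "(3::'a::field) = 0" "(x::'a) \<in> F3" "y \<in> F3"
  shows "x - y \<in> F3"
proof -
  have "x ^ 3 = (x - y) ^ 3 + y ^ 3"
    using cube_add[OF assms(1), of "x - y" y] by simp
  then show ?thesis using assms by (simp add: F3_iff_cube eq_diff_eq)
qed

lemma F3_add:
  assumes "(3::'a::field) = 0" "(x::'a) \<in> F3" "y \<in> F3"
  shows "x + y \<in> F3"
  using assms by (simp add: F3_iff_cube cube_add)

section \<open>Polynomials fixed by Frobenius\<close>

definition frob_poly :: "'a::field poly \<Rightarrow> 'a poly" where
  "frob_poly = map_poly (\<lambda>x. x ^ 3)"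

lemma coeff_frob_poly [simp]: "coeff (frob_poly p) i = coeff p i ^ 3"
  by (simp add: frob_poly_def coeff_map_poly)

lemma frob_poly_mult:
  assumes "(3::'a::field) = 0"
  shows "frob_poly ((p::'a poly) * q) = frob_poly p * frob_poly q"
  by (intro poly_eqI) (simp add: coeff_mult cube_sum assms power_mult_distrib)

lemma frob_poly_prod:
  assumes "(3::'a::field) = 0"
  shows "frob_poly (\<Prod>i\<in>A. (p i::'a poly)) = (\<Prod>i\<in>A. frob_poly (p i))"
proof -
  have "frob_poly (1::'a poly) = 1"
    by (intro poly_eqI) (simp add: power_0_left)
  then show ?thesis
    by (induction A rule: infinite_finite_induct) (simp_all add: frob_poly_mult assms)
qed

lemma frob_poly_linear: "frob_poly [:- r, 1:] = [:- (r ^ 3), 1:]"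
  by (intro poly_eqI) (auto simp: coeff_pCons power3_eq_cube split: nat.splits)

lemma inj_on_cube:
  assumes "(3::'a::field) = 0"
  shows "inj_on (\<lambda>x::'a. x ^ 3) A"
proof (rule inj_onI)
  fix x y :: 'a assume "x ^ 3 = y ^ 3"
  moreover have "x ^ 3 = (x - y) ^ 3 + y ^ 3"
    using cube_add[OF assms, of "x - y" y] by simp
  ultimately show "x = y" by simp
qed

text \<open>Cubing is injective and maps the finite set \<open>R\<close> into itself, so it permutes
  the linear factors.\<close>

lemma frob_poly_prod_roots:
  assumes "(3::'a::field) = 0" "finite R" "\<And>r. r \<in> R \<Longrightarrow> r ^ 3 \<in> R"
  shows "frob_poly (\<Prod>r\<in>R. [:- r, 1:]) = (\<Prod>r\<in>R. [:- (r::'a), 1:])"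
proof -
  have "(\<lambda>x. x ^ 3) ` R = R"
    using assms inj_on_cube by (intro endo_inj_surj) auto
  then have "(\<Prod>r\<in>R. [:- r, 1:]) = (\<Prod>r\<in>(\<lambda>x. x ^ 3) ` R. [:- r, 1:])" by simp
  also have "\<dots> = (\<Prod>r\<in>R. [:- (r ^ 3), 1:])"
    by (subst prod.reindex[OF inj_on_cube[OF assms(1)]]) simp
  finally show ?thesis unfolding frob_poly_prod[OF assms(1)] frob_poly_linear ..
qed

lemma prod_linear_dvd_iff:
  assumes "finite A" "inj_on f A"
  shows "(\<Prod>j\<in>A. [:- f j, 1:]) dvd p \<longleftrightarrow> (\<forall>j\<in>A. poly p (f j :: 'a::field) = 0)"
  using assms
proof (induction A arbitrary: p rule: finite_induct)
  case (insert a A)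
  show ?case
  proof
    assume "(\<Prod>j\<in>insert a A. [:- f j, 1:]) dvd p"
    then obtain q where "p = ([:- f a, 1:] * (\<Prod>j\<in>A. [:- f j, 1:])) * q"
      unfolding prod.insert[OF insert.hyps] by (elim dvdE)
    then show "\<forall>j\<in>insert a A. poly p (f j) = 0"
      using insert.hyps by (auto simp: poly_prod)
  next
    assume *: "\<forall>j\<in>insert a A. poly p (f j) = 0"
    then have "[:- f a, 1:] dvd p" by (simp add: poly_eq_0_iff_dvd)
    then obtain q where q: "p = [:- f a, 1:] * q" by (elim dvdE)
    have "poly q (f j) = 0" if "j \<in> A" for j
    proof -
      have "f j \<noteq> f a" using insert.hyps insert.prems that by (auto simp: inj_on_def)
      then show ?thesis using * that by (auto simp: q)
    qed
    then have "(\<Prod>j\<in>A. [:- f j, 1:]) dvd q"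
      using insert.IH insert.prems by simp
    then show "(\<Prod>j\<in>insert a A. [:- f j, 1:]) dvd p"
      unfolding q prod.insert[OF insert.hyps] by (rule mult_dvd_mono[OF dvd_refl])
  qed
qed simp

section \<open>Counting words with prescribed roots\<close>

lemma poly_Poly_eq_sum: "poly (Poly c) x = (\<Sum>i<length c. c ! i * x ^ i)"
  for x :: "'a::field"
  by (induction c)
    (simp_all add: sum.lessThan_Suc_shift sum_distrib_left mult_ac del: sum.lessThan_Suc)

text \<open>The degree bound is put on coefficients so that the zero polynomial belongs to the set
  even for \<open>k = 0\<close>.\<close>

definition F3_polys :: "nat \<Rightarrow> 'a::field poly set" where
  "F3_polys k = {p. (\<forall>i\<ge>k. coeff p i = 0) \<and> frob_poly p = p}"

lemma bij_betw_Poly_words: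
  assumes "(3::'a::field) = 0"
  shows "bij_betw (Poly :: 'a list \<Rightarrow> 'a poly) (words k) (F3_polys k)"
proof (rule bij_betw_byWitness[where f' = "\<lambda>p. map (coeff p) [0..<k]"])
  show "\<forall>c\<in>words k. map (coeff (Poly c)) [0..<k] = (c :: 'a list)"
    by (auto simp: words_def nth_default_def intro!: nth_equalityI)
  show "\<forall>p\<in>F3_polys k. Poly (map (coeff p) [0..<k]) = (p :: 'a poly)"
    by (auto simp: F3_polys_def nth_default_def intro!: poly_eqI)
  show "Poly ` words k \<subseteq> (F3_polys k :: 'a poly set)"
  proof -
    have "coeff (Poly c) i ^ 3 = coeff (Poly c) i" if "c \<in> words k" for c :: "'a list" and i
    proof (cases "i < k")
      case True
      then have "c ! i \<in> F3" using that by (auto simp: words_def)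
      then show ?thesis using that True by (simp add: words_def nth_default_def F3_iff_cube assms)
    qed (use that in \<open>simp add: words_def nth_default_def\<close>)
    then show ?thesis
      by (auto simp: F3_polys_def words_def nth_default_def intro!: poly_eqI)
  qed
  show "(\<lambda>p. map (coeff p) [0..<k]) ` F3_polys k \<subseteq> (words k :: 'a list set)"
    by (auto simp: F3_polys_def words_def F3_iff_cube assms) (metis coeff_frob_poly)
qed

lemma card_words:
  assumes "(3::'a::field) = 0"
  shows "card (words k :: 'a list set) = 3 ^ k"
proof -
  have fin: "finite (F3 :: 'a set)" by (simp add: F3_def)
  have "words k = {xs. set xs \<subseteq> (F3 :: 'a set) \<and> length xs = k}" by (auto simp: words_def)
  then show ?thesis
    using card_lists_length_eq[OF fin, of k] card_F3[OF assms] by simp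
qed

text \<open>Frobenius is multiplicative and fixes \<open>h\<close>, so it fixes \<open>h * q\<close>
  iff it fixes \<open>q\<close>; degrees of nonzero factors add up.\<close>

lemma bij_betw_mult_F3_polys:
  assumes three: "(3::'a::field) = 0" and "frob_poly h = (h::'a poly)" "h \<noteq> 0"
  shows "bij_betw ((*) h) (F3_polys k) {p \<in> F3_polys (degree h + k). h dvd p}"
  unfolding bij_betw_def
proof
  show "inj_on ((*) h) (F3_polys k)" using assms by (auto intro: inj_onI)
  have bound: "(\<forall>i\<ge>l. coeff p i = 0) \<longleftrightarrow> p = 0 \<or> degree p < l" for p :: "'a poly" and l
    using coeff_eq_0[of p] by (metis leading_coeff_0_iff linorder_not_le order_less_le_trans coeff_0)
  have frob: "frob_poly (h * q) = h * q \<longleftrightarrow> frob_poly q = q" for q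
    using assms by (simp add: frob_poly_mult)
  have "h * q \<in> F3_polys (degree h + k) \<longleftrightarrow> q \<in> F3_polys k" for q
    unfolding F3_polys_def mem_Collect_eq bound frob
    using assms(3) by (cases "q = 0") (simp_all add: degree_mult_eq)
  then show "(*) h ` F3_polys k = {p \<in> F3_polys (degree h + k). h dvd p}"
    by (auto elim!: dvdE)
qed

text \<open>The words correspond to the multiples of the product of all linear factors over
  \<open>R\<close>; the cofactors range freely over prime field polynomials with
  \<open>n - card R\<close> coefficients.\<close>

lemma card_words_with_roots:
  assumes three: "(3::'a::field) = 0" and R: "finite R" "\<And>r. r \<in> R \<Longrightarrow> r ^ 3 \<in> R"
    and "card R \<le> n"
  shows "card {v \<in> words n. \<forall>r\<in>R. poly (Poly v) (r::'a) = 0} = 3 ^ (n - card R)"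
proof -
  define h where "h = (\<Prod>r\<in>R. [:- r, 1:])"
  have h: "h \<noteq> 0" "frob_poly h = h" "degree h = card R"
    using R frob_poly_prod_roots[OF three R]
    by (auto simp: h_def degree_prod_eq_sum_degree)
  have "{v \<in> words n. \<forall>r\<in>R. poly (Poly v) r = 0} = {v \<in> words n. h dvd Poly v}"
    using prod_linear_dvd_iff[OF R(1), of "\<lambda>r. r"] by (simp add: h_def)
  moreover have "bij_betw Poly {v \<in> words n. h dvd Poly v} {p \<in> F3_polys n. h dvd p}"
    using bij_betw_Poly_words[OF three, of n] by (auto simp: bij_betw_def inj_on_def)
  moreover have "bij_betw ((*) h) (F3_polys (n - card R)) {p \<in> F3_polys n. h dvd p}"
    using bij_betw_mult_F3_polys[OF three h(2,1), of "n - card R"] assms(4) h(3) by simp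
  moreover note bij_betw_Poly_words[OF three, of "n - card R"]
  ultimately show ?thesis
    using card_words[OF three, of "n - card R"] by (simp add: bij_betw_same_card)
qed

section \<open>The dual code by its zeros\<close>

lemma geometric_sum_root_of_unity:
  fixes y :: "'a::field"
  assumes "y ^ k = 1" "y \<noteq> 1"
  shows "(\<Sum>i<k. y ^ i) = 0"
  using assms by (simp add: geometric_sum)

text \<open>This is the BCH bound. With at most \<open>k\<close> support points, some polynomial of
  degree below \<open>k\<close> vanishes at all of them except \<open>i0\<close>; applied to the
  vanishing power sums, it isolates the term of \<open>i0\<close>.\<close>

lemma Vandermonde_support_bound:
  fixes d Y :: "'b \<Rightarrow> 'a::field"
  assumes "finite A" "inj_on Y A" and zero: "\<And>l. l < k \<Longrightarrow> (\<Sum>i\<in>A. d i * Y i ^ l) = 0"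
    and "i0 \<in> A" "d i0 \<noteq> 0"
  shows "k < card {i \<in> A. d i \<noteq> 0}"
proof (rule ccontr)
  assume le: "\<not> k < card {i \<in> A. d i \<noteq> 0}"
  define B where "B = {i \<in> A. d i \<noteq> 0} - {i0}"
  define P where "P = (\<Prod>i\<in>B. [:- Y i, 1:])"
  have fin: "finite B" using assms(1) by (simp add: B_def)
  have cB: "card B < k"
  proof -
    have "card {i \<in> A. d i \<noteq> 0} > 0" "card B = card {i \<in> A. d i \<noteq> 0} - 1"
      using assms by (auto simp: B_def card_gt_0_iff)
    then show ?thesis using le by linarith
  qed
  have degP: "degree P = card B"
    by (simp add: P_def degree_prod_eq_sum_degree)
  have "0 = (\<Sum>l\<le>degree P. coeff P l * (\<Sum>i\<in>A. d i * Y i ^ l))"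
    using zero cB degP by simp
  also have "\<dots> = (\<Sum>i\<in>A. d i * poly P (Y i))"
    unfolding sum_distrib_left poly_altdef
    by (subst sum.swap) (intro sum.cong refl, simp add: mult_ac)
  also have "\<dots> = (\<Sum>i\<in>A. if i = i0 then d i0 * poly P (Y i0) else 0)"
    using fin by (intro sum.cong refl) (auto simp: P_def poly_prod B_def)
  also have "\<dots> = d i0 * poly P (Y i0)"
    using assms by simp
  finally have "poly P (Y i0) = 0" using assms by simp
  then obtain i where "i \<in> B" "Y i = Y i0"
    using fin by (auto simp: P_def poly_prod)
  then show False
    using assms by (auto simp: B_def inj_on_def)
qed

section \<open>Arithmetic of the field with \<open>3 ^ m\<close> elements\<close>

locale ternary_field =
  fixes m :: nat and \<alpha> :: "'a::field"
  assumes card_UNIV: "card (UNIV :: 'a set) = 3 ^ m"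
    and m_ge_3: "3 \<le> m"
    and primitive: "primitive_elem \<alpha>"
begin

definition n :: nat where "n = 3 ^ m - 1"

lemma n_ge: "26 \<le> n"
proof -
  have "(3::nat) ^ 3 \<le> 3 ^ m" using m_ge_3 by (intro power_increasing) auto
  then show ?thesis by (simp add: n_def)
qed

lemma Suc_n: "Suc n = 3 ^ m" by (simp add: n_def)

lemma finite_field: "finite (UNIV :: 'a set)"
  using card_UNIV by (metis card.infinite power_not_zero zero_neq_numeral)

text \<open>Translation by 1 permutes the field, so comparing the sums of all elements gives
  \<open>3 ^ m = 0\<close>.\<close>

lemma three_eq_0: "(3::'a) = 0"
proof -
  have "(\<Sum>x\<in>UNIV. x + (1::'a)) = (\<Sum>x\<in>UNIV. x)"
    by (rule sum.reindex_bij_witness[of _ "\<lambda>x. x - 1" "\<lambda>x. x + 1"]) auto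
  then have "of_nat (card (UNIV::'a set)) = (0::'a)"
    by (simp add: sum.distrib)
  then show ?thesis by (simp add: card_UNIV)
qed

lemma two_neq_0: "(2::'a) \<noteq> 0"
  using two_neq_0_char_3 three_eq_0 by blast

lemma of_nat_eq_0_iff_dvd: "of_nat k = (0::'a) \<longleftrightarrow> 3 dvd k"
proof -
  have "of_nat k = (of_nat (3 * (k div 3) + k mod 3) :: 'a)" by simp
  also have "\<dots> = of_nat (k mod 3)"
    unfolding of_nat_add of_nat_mult by (simp add: three_eq_0)
  finally have *: "of_nat k = (of_nat (k mod 3) :: 'a)" .
  have "k mod 3 = 0 \<or> k mod 3 = 1 \<or> k mod 3 = 2" by presburger
  then show ?thesis unfolding * using two_neq_0 by (auto simp: dvd_eq_mod_eq_0)
qed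

lemma of_nat_n: "of_nat n = (- 1 :: 'a)"
proof -
  have "of_nat (Suc n) = (0::'a)"
    unfolding Suc_n using three_eq_0 m_ge_3 by (simp add: power_0_left)
  then show ?thesis by (simp add: add_eq_0_iff)
qed

text \<open>Multiplication by \<open>x\<close> permutes the nonzero elements; compare the products
  of all of them.\<close>

lemma power_n_eq_1:
  assumes "(x::'a) \<noteq> 0"
  shows "x ^ n = 1"
proof -
  have "(\<Prod>y\<in>UNIV - {0}. x * y) = (\<Prod>y\<in>UNIV - {0}. y)"
    by (rule prod.reindex_bij_witness[of _ "\<lambda>y. y / x" "\<lambda>y. x * y"]) (use assms in auto)
  then have "x ^ card (UNIV - {0::'a}) * \<Prod>(UNIV - {0}) = \<Prod>(UNIV - {0::'a})"
    by (simp add: prod.distrib)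
  moreover have "\<Prod>(UNIV - {0::'a}) \<noteq> 0" using finite_field by simp
  moreover have "card (UNIV - {0::'a}) = n" using finite_field by (simp add: card_UNIV n_def)
  ultimately show ?thesis by simp
qed

lemma power_3_power_m: "(x::'a) ^ (3 ^ m) = x"
  using power_n_eq_1[of x] by (cases "x = 0") (simp_all flip: Suc_n)

lemma \<alpha>_neq_0 [simp]: "\<alpha> \<noteq> 0"
  using primitive by (simp add: primitive_elem_def)

lemma \<alpha>_power_mod: "\<alpha> ^ (e mod n) = \<alpha> ^ e"
proof -
  have "\<alpha> ^ e = \<alpha> ^ (n * (e div n) + e mod n)" by simp
  also have "\<dots> = \<alpha> ^ (e mod n)"
    unfolding power_add power_mult by (simp add: power_n_eq_1)
  finally show ?thesis ..
qed

text \<open>By primitivity the first \<open>n\<close> powers hit all \<open>n\<close> nonzero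
  elements, so none is hit twice.\<close>

lemma \<alpha>_inj: "inj_on (\<lambda>i. \<alpha> ^ i) {..<n}"
proof (rule eq_card_imp_inj_on)
  have "UNIV - {0} \<subseteq> (\<lambda>i. \<alpha> ^ i) ` {..<n}"
  proof
    fix x :: 'a assume "x \<in> UNIV - {0}"
    then obtain j where "x = \<alpha> ^ j" using primitive by (auto simp: primitive_elem_def)
    then show "x \<in> (\<lambda>i. \<alpha> ^ i) ` {..<n}"
      using n_ge by (intro image_eqI[of _ _ "j mod n"]) (auto simp: \<alpha>_power_mod)
  qed
  then have "(\<lambda>i. \<alpha> ^ i) ` {..<n} = UNIV - {0}" by auto
  then show "card ((\<lambda>i. \<alpha> ^ i) ` {..<n}) = card {..<n}"
    using finite_field by (simp add: card_UNIV n_def)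
qed simp

lemma \<alpha>_power_eq_iff: "\<alpha> ^ i = \<alpha> ^ j \<longleftrightarrow> i mod n = j mod n"
proof
  assume "\<alpha> ^ i = \<alpha> ^ j"
  then have "\<alpha> ^ (i mod n) = \<alpha> ^ (j mod n)" by (simp add: \<alpha>_power_mod)
  then show "i mod n = j mod n" using \<alpha>_inj n_ge by (auto dest!: inj_onD)
qed (metis \<alpha>_power_mod)

section \<open>The absolute trace\<close>

definition tr :: "'a \<Rightarrow> 'a" where "tr x = (\<Sum>t<m. x ^ (3 ^ t))"

lemma tr_in_F3: "tr x \<in> F3"
proof -
  have "tr x ^ 3 = (\<Sum>t<m. x ^ (3 ^ Suc t))"
    by (simp add: tr_def cube_sum three_eq_0 power_mult mult.commute[of 3])
  moreover have "(\<Sum>t<Suc m. x ^ (3 ^ t)) = x + (\<Sum>t<m. x ^ (3 ^ Suc t))"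
    by (subst sum.lessThan_Suc_shift) simp
  moreover have "(\<Sum>t<Suc m. x ^ (3 ^ t)) = tr x + x"
    by (simp add: tr_def power_3_power_m)
  ultimately show ?thesis
    unfolding F3_iff_cube[OF three_eq_0] by simp
qed

text \<open>The trace is a polynomial function of degree at most \<open>3 ^ (m - 1)\<close>, too
  small for \<open>3 ^ m\<close> roots.\<close>

lemma tr_nonzero: "\<exists>x. tr x \<noteq> 0"
proof (rule ccontr)
  assume "\<nexists>x. tr x \<noteq> 0"
  then have all0: "tr x = 0" for x by blast
  define p :: "'a poly" where "p = (\<Sum>t<m. monom 1 (3 ^ t))"
  have poly_p: "poly p x = tr x" for x
    by (simp add: p_def poly_sum poly_monom tr_def)
  have "coeff p 1 = (\<Sum>t<m. if t = 0 then 1 else 0)"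
    unfolding p_def coeff_sum coeff_monom by (intro sum.cong) auto
  then have "p \<noteq> 0" using m_ge_3 by auto
  then have "3 ^ m \<le> degree p"
    using card_poly_roots_bound[of p] by (simp add: poly_p all0 card_UNIV)
  also have "degree p \<le> 3 ^ (m - 1)"
    unfolding p_def by (intro degree_sum_le) (auto simp: degree_monom_eq intro!: power_increasing)
  also have "\<dots> < (3::nat) ^ m" using m_ge_3 by (intro power_strict_increasing) auto
  finally show False by simp
qed

section \<open>The Fourier transform of a word\<close>

definition spectrum :: "(nat \<Rightarrow> 'a) \<Rightarrow> nat \<Rightarrow> 'a" where
  "spectrum c e = (\<Sum>i<n. c i * \<alpha> ^ (i * e))"

lemma spectrum_eq_poly: "length c = n \<Longrightarrow> spectrum ((!) c) e = poly (Poly c) (\<alpha> ^ e)"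
  by (simp add: spectrum_def poly_Poly_eq_sum mult.commute flip: power_mult)

lemma spectrum_mod: "spectrum c (e mod n) = spectrum c e"
  unfolding spectrum_def
  by (intro sum.cong refl) (simp add: \<alpha>_power_eq_iff mod_mult_right_eq)

text \<open>Frobenius fixes the entries of the word and acts only on the powers of \<alpha>.\<close>

lemma spectrum_power:
  assumes "\<And>i. i < n \<Longrightarrow> c i \<in> F3"
  shows "spectrum c (3 ^ t * e) = spectrum c e ^ (3 ^ t)"
  unfolding spectrum_def sum_power_3_power[OF three_eq_0] power_mult_distrib
  using assms
  by (intro sum.cong refl) (simp add: F3_power_3_power three_eq_0 mult_ac flip: power_mult)

text \<open>The element \<open>\<alpha> ^ l\<close> has order \<open>k\<close>, so geometric sums
  give orthogonality. The case \<open>l = 1\<close> serves full words, \<open>l = 2\<close> folded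
  ones.\<close>

lemma Parseval:
  assumes "k * l = n"
  shows "(\<Sum>j<k. (\<Sum>p<k. f p * \<alpha> ^ (p * (l * j))) * (\<Sum>q<k. g q * \<alpha> ^ (q * (n - l * j))))
    = of_nat k * (\<Sum>p<k. f p * (g p :: 'a))"
proof -
  have l: "l > 0" "k > 0" using assms n_ge by (auto intro!: Nat.gr0I)
  have orth: "(\<Sum>j<k. \<alpha> ^ (p * (l * j)) * \<alpha> ^ (q * (n - l * j))) = (if p = q then of_nat k else 0)"
    if "p < k" "q < k" for p q
  proof -
    define y where "y = \<alpha> ^ (l * p) / \<alpha> ^ (l * q)"
    have "\<alpha> ^ (p * (l * j)) * \<alpha> ^ (q * (n - l * j)) = y ^ j" if "j < k" for j
    proof -
      have "l * j \<le> n" using that assms by (metis less_imp_le mult.commute mult_le_mono1)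
      then have "\<alpha> ^ (q * (n - l * j)) * \<alpha> ^ (q * (l * j)) = \<alpha> ^ (n * q)"
        by (simp add: mult.commute flip: power_add add_mult_distrib2)
      then have "\<alpha> ^ (q * (n - l * j)) * \<alpha> ^ (q * (l * j)) = 1"
        by (simp add: power_mult power_n_eq_1)
      then show ?thesis
        by (simp add: y_def power_divide field_simps mult_ac flip: power_mult)
    qed
    then have "(\<Sum>j<k. \<alpha> ^ (p * (l * j)) * \<alpha> ^ (q * (n - l * j))) = (\<Sum>j<k. y ^ j)" by simp
    moreover have "y = 1 \<longleftrightarrow> p = q"
    proof -
      have "l * p < n" "l * q < n" using that l by (simp_all flip: assms add: mult.commute[of k])
      then show ?thesis using l by (auto simp: y_def \<alpha>_power_eq_iff)
    qed
    moreover have "y ^ k = 1"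
    proof -
      have "y ^ k = \<alpha> ^ (n * p) / \<alpha> ^ (n * q)"
        by (simp add: y_def power_divide flip: power_mult assms(1)) (simp add: mult_ac)
      then show ?thesis by (simp add: power_mult power_n_eq_1)
    qed
    ultimately show ?thesis by (auto simp: geometric_sum_root_of_unity)
  qed
  have "(\<Sum>j<k. (\<Sum>p<k. f p * \<alpha> ^ (p * (l * j))) * (\<Sum>q<k. g q * \<alpha> ^ (q * (n - l * j))))
    = (\<Sum>j<k. \<Sum>p<k. \<Sum>q<k. f p * g q * (\<alpha> ^ (p * (l * j)) * \<alpha> ^ (q * (n - l * j))))"
    by (simp add: sum_product mult_ac)
  also have "\<dots> = (\<Sum>p<k. \<Sum>q<k. \<Sum>j<k. f p * g q * (\<alpha> ^ (p * (l * j)) * \<alpha> ^ (q * (n - l * j))))"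
    by (subst sum.swap) (rule sum.cong[OF refl], rule sum.swap)
  also have "\<dots> = (\<Sum>p<k. \<Sum>q<k. if p = q then f p * g q * of_nat k else 0)"
    by (intro sum.cong refl) (simp add: orth flip: sum_distrib_left)
  also have "\<dots> = of_nat k * (\<Sum>p<k. f p * g p)"
    by (simp add: sum_distrib_left mult_ac)
  finally show ?thesis .
qed

section \<open>Ternary weights modulo \<open>n\<close> and cyclotomic cosets\<close>

lemma w3_minus: "e < n \<Longrightarrow> w3 (n - e) + w3 e = 2 * m"
  using w3_complement[of e m] by (simp add: n_def)

text \<open>Modulo \<open>3 ^ m - 1\<close>, multiplication by 3 rotates the \<open>m\<close>
  digits: the top digit \<open>q\<close> re-enters at the bottom.\<close>

lemma w3_times_3_mod:
  assumes "j < n"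
  shows "w3 (3 * j mod n) = w3 j"
proof -
  define q r where "q = j div 3 ^ (m - 1)" and "r = j mod 3 ^ (m - 1)"
  have m: "3 ^ m = (3::nat) * 3 ^ (m - 1)"
    using m_ge_3 by (metis Suc_diff_1 Suc_le_lessD less_le_trans power_Suc zero_less_numeral)
  have j: "j = q * 3 ^ (m - 1) + r" "r < 3 ^ (m - 1)"
    unfolding q_def r_def by (rule div_mult_mod_eq[symmetric]) simp
  have q: "q < 3" using assms m
    by (simp add: q_def n_def less_mult_imp_div_less)
  have "3 * j = q * 3 ^ m + 3 * r"
    unfolding m by (subst j(1)) simp
  then have "3 * j = n * q + (3 * r + q)"
    unfolding Suc_n[symmetric] by simp
  moreover have "3 * r + q < n"
  proof -
    have "q = 0 \<or> q = 1 \<or> q = 2" using q by linarith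
    moreover have "n = 3 * 3 ^ (m - 1) - 1" by (simp add: n_def m)
    ultimately show ?thesis using j assms by (elim disjE) simp_all
  qed
  ultimately have "3 * j mod n = 3 * r + q" by simp
  then show ?thesis
    using j q w3_shift_add[OF j(2), of q] w3_triple_add[OF q, of 0]
    by (simp add: w3_triple_add)
qed

lemma w3_times_3_power_mod: "j < n \<Longrightarrow> w3 (3 ^ t * j mod n) = w3 j"
proof (induction t)
  case (Suc t)
  have "w3 (3 * (3 ^ t * j mod n) mod n) = w3 (3 ^ t * j mod n)"
    using n_ge by (intro w3_times_3_mod) simp
  then show ?case using Suc by (simp add: mod_mult_right_eq mult.assoc)
qed simp

lemma T_set_iff: "j \<in> T_set i1 i2 m \<longleftrightarrow> j < n \<and> j \<noteq> 0 \<and> (w3 j mod 4 = i1 \<or> w3 j mod 4 = i2)"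
  using n_ge by (auto simp: T_set_def n_def)

text \<open>Digit rotation preserves weight, so \<open>T_set\<close> is a union of cyclotomic
  cosets.\<close>

lemma T_set_closed:
  assumes "l \<in> T_set i1 i2 m" "j < n" "l = 3 ^ t * j mod n"
  shows "j \<in> T_set i1 i2 m"
  using assms w3_times_3_power_mod[OF assms(2), of t] by (cases "j = 0") (auto simp: T_set_iff)

section \<open>The code and its dual through their spectra\<close>

lemma code_C_iff:
  "c \<in> code_C i1 i2 m \<alpha> \<longleftrightarrow> c \<in> words n \<and> (\<forall>j\<in>T_set i1 i2 m. spectrum ((!) c) j = 0)"
proof -
  have "T_set i1 i2 m \<subseteq> {..<n}" by (auto simp: T_set_iff)
  then have "finite (T_set i1 i2 m)" "inj_on (\<lambda>j. \<alpha> ^ j) (T_set i1 i2 m)"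
    using \<alpha>_inj by (auto intro: finite_subset inj_on_subset)
  note prod_linear_dvd_iff[OF this, of "Poly c"]
  then show ?thesis
    by (auto simp: code_C_def cyclic_code_def gen_poly_def words_def spectrum_eq_poly
        simp flip: n_def simp del: One_nat_def)
qed

text \<open>Expanding the trace gives geometric sums with ratios
  \<open>\<alpha> ^ (3 ^ t * (n - j) + l)\<close>. A ratio is 1 only if \<open>l\<close> lies in the
  coset of \<open>j\<close>, which misses \<open>T_set\<close>.\<close>

lemma trace_word_in_code:
  assumes "j < n" "j \<notin> T_set i1 i2 m"
  shows "map (\<lambda>i. tr (x * \<alpha> ^ (i * (n - j)))) [0..<n] \<in> code_C i1 i2 m \<alpha>" (is "?c \<in> _")
  unfolding code_C_iff
proof (intro conjI ballI)
  show "?c \<in> words n" using tr_in_F3 by (auto simp: words_def)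
  fix l assume l: "l \<in> T_set i1 i2 m"
  have "spectrum ((!) ?c) l = (\<Sum>i<n. \<Sum>t<m. x ^ 3 ^ t * (\<alpha> ^ (3 ^ t * (n - j) + l)) ^ i)"
    unfolding spectrum_def
    by (intro sum.cong refl)
      (simp add: tr_def sum_distrib_left sum_distrib_right power_mult_distrib power_add mult_ac
        flip: power_mult)
  also have "\<dots> = (\<Sum>t<m. x ^ 3 ^ t * (\<Sum>i<n. (\<alpha> ^ (3 ^ t * (n - j) + l)) ^ i))"
    by (subst sum.swap) (simp add: sum_distrib_left)
  also have "\<dots> = 0"
  proof (intro sum.neutral ballI)
    fix t
    have "\<alpha> ^ (3 ^ t * (n - j) + l) \<noteq> 1"
    proof
      assume "\<alpha> ^ (3 ^ t * (n - j) + l) = 1"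
      then have "\<alpha> ^ (3 ^ t * j) = \<alpha> ^ (3 ^ t * (n - j) + l) * \<alpha> ^ (3 ^ t * j)" by simp
      also have "\<dots> = \<alpha> ^ (n * 3 ^ t + l)"
      proof -
        have "3 ^ t * (n - j) + 3 ^ t * j = n * 3 ^ t"
          using assms(1) by (simp flip: add_mult_distrib2)
        then have "3 ^ t * (n - j) + l + 3 ^ t * j = n * 3 ^ t + l" by simp
        then show ?thesis by (simp only: flip: power_add)
      qed
      also have "\<dots> = \<alpha> ^ l" unfolding power_add power_mult by (simp add: power_n_eq_1)
      finally have "l = 3 ^ t * j mod n" using l by (simp add: \<alpha>_power_eq_iff T_set_iff)
      then show False using T_set_closed assms l by blast
    qed
    moreover have "(\<alpha> ^ (3 ^ t * (n - j) + l)) ^ n = 1" by (simp add: power_n_eq_1)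
    ultimately show "x ^ 3 ^ t * (\<Sum>i<n. (\<alpha> ^ (3 ^ t * (n - j) + l)) ^ i) = 0"
      by (simp add: geometric_sum_root_of_unity)
  qed
  finally show "spectrum ((!) ?c) l = 0" .
qed

text \<open>Forward, orthogonality to all trace words at \<open>j\<close> forces the value at
  \<open>n - j\<close> to vanish. Backward, every product in Parseval's identity has a zero
  factor.\<close>

lemma dual_code_C_iff:
  "v \<in> dual_code n (code_C i1 i2 m \<alpha>) \<longleftrightarrow>
    v \<in> words n \<and> (\<forall>j<n. j \<notin> T_set i1 i2 m \<longrightarrow> spectrum ((!) v) (n - j) = 0)"
proof (intro iffI conjI allI impI)
  assume v: "v \<in> dual_code n (code_C i1 i2 m \<alpha>)"
  then show words: "v \<in> words n" by (simp add: dual_code_def)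
  fix j assume j: "j < n" "j \<notin> T_set i1 i2 m"
  show "spectrum ((!) v) (n - j) = 0"
  proof (rule ccontr)
    assume neq: "spectrum ((!) v) (n - j) \<noteq> 0"
    obtain y where y: "tr y \<noteq> 0" using tr_nonzero by blast
    \<comment> \<open>This multiplier turns the inner product with the trace word into
      \<open>tr y\<close>.\<close>
    define x where "x = y / spectrum ((!) v) (n - j)"
    have "v ! i \<in> F3" if "i < n" for i using words that by (auto simp: words_def)
    note pow = F3_power_3_power[OF three_eq_0 this]
    have "0 = (\<Sum>i<n. tr (x * \<alpha> ^ (i * (n - j))) * v ! i)"
      using v trace_word_in_code[OF j, of x] by (auto simp: dual_code_def)
    also have "\<dots> = (\<Sum>i<n. \<Sum>t<m. (x * (v ! i * \<alpha> ^ (i * (n - j)))) ^ 3 ^ t)"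
      by (intro sum.cong refl)
        (simp add: tr_def sum_distrib_left sum_distrib_right power_mult_distrib pow mult_ac)
    also have "\<dots> = (\<Sum>t<m. (\<Sum>i<n. x * (v ! i * \<alpha> ^ (i * (n - j)))) ^ 3 ^ t)"
      by (subst sum.swap) (simp add: sum_power_3_power three_eq_0)
    also have "\<dots> = tr (x * spectrum ((!) v) (n - j))"
      by (simp add: tr_def spectrum_def sum_distrib_left)
    also have "\<dots> = tr y" using neq by (simp add: x_def)
    finally show False using y by simp
  qed
next
  assume v: "v \<in> words n \<and> (\<forall>j<n. j \<notin> T_set i1 i2 m \<longrightarrow> spectrum ((!) v) (n - j) = 0)"
  have "(\<Sum>i<n. c ! i * v ! i) = 0" if "c \<in> code_C i1 i2 m \<alpha>" for c
  proof -
    have "of_nat n * (\<Sum>i<n. c ! i * v ! i) = (\<Sum>j<n. spectrum ((!) c) j * spectrum ((!) v) (n - j))"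
      using Parseval[of n 1 "(!) c" "(!) v"] by (simp add: spectrum_def)
    also have "\<dots> = 0"
      using v that by (intro sum.neutral) (auto simp: code_C_iff)
    finally show ?thesis by (simp add: of_nat_n)
  qed
  then show "v \<in> dual_code n (code_C i1 i2 m \<alpha>)" using v by (simp add: dual_code_def)
qed

text \<open>The prescribed roots \<open>\<alpha> ^ (n - j)\<close>, for \<open>j\<close> outside
  \<open>T_set\<close>, are distinct and closed under cubing, so
  \<open>card_words_with_roots\<close> applies.\<close>

lemma card_dual_code_C:
  "card (dual_code n (code_C i1 i2 m \<alpha>)) = 3 ^ card (T_set i1 i2 m)"
proof -
  let ?T = "T_set i1 i2 m"
  define R where "R = (\<lambda>j. \<alpha> ^ (n - j)) ` ({..<n} - ?T)"
  have T: "?T \<subseteq> {..<n}" by (auto simp: T_set_iff)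
  have inv: "\<alpha> ^ (n - j) * \<alpha> ^ j = 1" if "j < n" for j
    using that by (simp add: power_n_eq_1 flip: power_add)
  have "inj_on (\<lambda>j. \<alpha> ^ (n - j)) {..<n}"
  proof (rule inj_onI)
    fix i j assume ij: "i \<in> {..<n}" "j \<in> {..<n}" "\<alpha> ^ (n - i) = \<alpha> ^ (n - j)"
    then have "\<alpha> ^ (n - j) * \<alpha> ^ i = \<alpha> ^ (n - j) * \<alpha> ^ j" using inv[of i] inv[of j] by simp
    then show "i = j" using ij by (simp add: \<alpha>_power_eq_iff)
  qed
  then have "card R = card ({..<n} - ?T)"
    unfolding R_def by (intro card_image) (auto intro: inj_on_subset)
  then have card_R: "card R = n - card ?T" "card ?T \<le> n"
    using T card_mono[OF _ T] by (simp_all add: card_Diff_subset finite_subset)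
  have R3: "r ^ 3 \<in> R" if "r \<in> R" for r
  proof -
    obtain j where j: "j < n" "j \<notin> ?T" "r = \<alpha> ^ (n - j)" using \<open>r \<in> R\<close> by (auto simp: R_def)
    let ?j = "3 * j mod n"
    have lt: "?j < n" using n_ge by simp
    have "?j \<notin> ?T" using T_set_closed[of ?j i1 i2 j 1] j(1,2) unfolding power_one_right by blast
    moreover have "r ^ 3 = \<alpha> ^ (n - ?j)"
    proof -
      have "(\<alpha> ^ (n - j) * \<alpha> ^ j) ^ 3 = \<alpha> ^ (n - ?j) * \<alpha> ^ ?j"
        by (simp only: inv[OF j(1)] inv[OF lt] power_one)
      moreover have "\<alpha> ^ ?j = (\<alpha> ^ j) ^ 3"
        by (metis \<alpha>_power_mod mult.commute power_mult)
      ultimately show ?thesis by (simp add: j power_mult_distrib)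
    qed
    ultimately show ?thesis using lt by (auto simp: R_def)
  qed
  have "dual_code n (code_C i1 i2 m \<alpha>) = {v \<in> words n. \<forall>r\<in>R. poly (Poly v) r = 0}"
    by (auto simp: dual_code_C_iff R_def words_def spectrum_eq_poly)
  moreover have "finite R" by (simp add: R_def)
  ultimately show ?thesis
    using card_words_with_roots[OF three_eq_0 _ R3, of n] card_R by simp
qed

end

section \<open>Weights of codewords\<close>

lemma sum_lessThan_add:
  "(\<Sum>i<k + l. f i) = (\<Sum>i<k. f i) + (\<Sum>i<l. f (i + k))"
  for f :: "nat \<Rightarrow> 'b::comm_monoid_add"
  by (induction l) (simp_all add: add_ac)

lemma sum_atMost_7:
  "(\<Sum>k\<le>7. f k) = f 0 + f 1 + f 2 + f 3 + f 4 + f 5 + f 6 + f 7"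
  for f :: "nat \<Rightarrow> 'b::comm_monoid_add"
  by (simp add: eval_nat_numeral)

lemma add_3_le_if_mod_3:
  fixes x k :: nat
  shows "x + 1 < k \<Longrightarrow> x mod 3 = 0 \<Longrightarrow> k mod 3 = 0 \<Longrightarrow> x + 3 \<le> k"
  by presburger

text \<open>Meant for the weights of \<open>n - e\<close> and \<open>e\<close>, whose sum is 2
  modulo 4. The first part serves the self-orthogonality of folded words, the second the transfer of
  the zeros of the dual code.\<close>

lemma complementary_mod_4:
  fixes v w m :: nat
  assumes "v + w = 2 * m" "odd m"
  shows "even w \<Longrightarrow> w mod 4 \<noteq> 2 \<Longrightarrow> v mod 4 = 2"
    and "w mod 4 = 1 \<or> w mod 4 = 2 \<Longrightarrow> v mod 4 \<noteq> 2 \<and> v mod 4 \<noteq> 3"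
proof -
  have "2 * m mod 4 = 2" using \<open>odd m\<close> by presburger
  then have "(v mod 4 + w mod 4) mod 4 = 2" using assms(1) by (simp add: mod_add_eq)
  moreover have "v mod 4 \<in> {0, 1, 2, 3}" "w mod 4 \<in> {0, 1, 2, 3}" by auto
  moreover have "even w \<longleftrightarrow> even (w mod 4)" by (simp add: dvd_mod_iff)
  ultimately show "even w \<Longrightarrow> w mod 4 \<noteq> 2 \<Longrightarrow> v mod 4 = 2"
    and "w mod 4 = 1 \<or> w mod 4 = 2 \<Longrightarrow> v mod 4 \<noteq> 2 \<and> v mod 4 \<noteq> 3"
    by auto
qed

text \<open>Stands for the difference of two distinct dual codewords: the listed
  \<open>e > 0\<close> are those with \<open>n - e\<close> outside
  \<open>T_set 2 3 m\<close>.\<close>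

locale ternary_word = ternary_field +
  fixes c :: "nat \<Rightarrow> 'a"
  assumes odd_m: "odd m"
    and c_F3: "i < n \<Longrightarrow> c i \<in> F3"
    and spectrum_zero: "\<lbrakk>e < n; e = 0 \<or> w3 e mod 4 = 1 \<or> w3 e mod 4 = 2\<rbrakk> \<Longrightarrow> spectrum c e = 0"
    and nonzero: "\<exists>i<n. c i \<noteq> 0"
begin

section \<open>Folding a word in half\<close>

definition wt :: nat where "wt = card {i. i < n \<and> c i \<noteq> 0}"

definition N :: nat where "N = n div 2"

text \<open>For \<open>p < N\<close> these are the coefficients of the word polynomial reduced
  modulo \<open>x ^ N - 1\<close>.\<close>

definition folded :: "nat \<Rightarrow> 'a" where "folded p = c p + c (p + N)"

lemma n_eq: "n = N + N"
proof -
  have "even n" by (simp add: n_def)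
  then show ?thesis by (auto simp: N_def)
qed

lemma \<alpha>_power_N: "\<alpha> ^ N = - 1"
proof -
  have "\<alpha> ^ N * \<alpha> ^ N = 1" by (simp add: power_n_eq_1 flip: power_add n_eq)
  then have "(\<alpha> ^ N - 1) * (\<alpha> ^ N + 1) = 0" by (simp add: algebra_simps)
  moreover have "\<alpha> ^ N \<noteq> \<alpha> ^ 0"
    using n_ge n_eq by (simp only: \<alpha>_power_eq_iff) simp
  ultimately show ?thesis by (simp add: add_eq_0_iff2)
qed

lemma spectrum_halves: "spectrum c e = (\<Sum>p<N. (c p + (- 1) ^ e * c (p + N)) * \<alpha> ^ (p * e))"
proof -
  have "\<alpha> ^ (N * e) = (- 1) ^ e" by (simp add: power_mult \<alpha>_power_N)
  then show ?thesis
    unfolding spectrum_def n_eq sum_lessThan_add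
    by (simp add: algebra_simps power_add sum.distrib)
qed

lemma spectrum_even: "even e \<Longrightarrow> spectrum c e = (\<Sum>p<N. folded p * \<alpha> ^ (p * e))"
  by (simp add: spectrum_halves folded_def)

lemma spectrum_odd:
  assumes "\<And>p. p < N \<Longrightarrow> folded p = 0" "odd e"
  shows "spectrum c e = 2 * (\<Sum>p<N. c p * \<alpha> ^ (p * e))"
proof -
  have "c (p + N) = - c p" if "p < N" for p
    using assms(1)[OF that] by (simp add: folded_def add_eq_0_iff)
  then show ?thesis using assms(2)
    by (simp add: spectrum_halves sum_distrib_left algebra_simps)
qed

text \<open>A nonzero \<open>folded p\<close> needs a nonzero entry at \<open>p\<close> or
  \<open>p + N\<close>; choosing one is injective.\<close>

lemma card_folded_le_wt: "card {p. p < N \<and> folded p \<noteq> 0} \<le> wt"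
  unfolding wt_def
proof (rule card_inj_on_le)
  let ?f = "\<lambda>p. if c p \<noteq> 0 then p else p + N"
  show "inj_on ?f {p. p < N \<and> folded p \<noteq> 0}" by (auto simp: inj_on_def)
  show "?f ` {p. p < N \<and> folded p \<noteq> 0} \<subseteq> {i. i < n \<and> c i \<noteq> 0}"
    by (auto simp: n_eq folded_def)
qed simp

text \<open>The second half is the negative of the first, so both have the same support up to the
  shift by \<open>N\<close>.\<close>

lemma wt_if_folded_zero:
  assumes "\<And>p. p < N \<Longrightarrow> folded p = 0"
  shows "wt = 2 * card {p. p < N \<and> c p \<noteq> 0}" "\<exists>p<N. c p \<noteq> 0"
proof -
  let ?A = "{p. p < N \<and> c p \<noteq> 0}"
  have shift: "c (p + N) \<noteq> 0 \<longleftrightarrow> c p \<noteq> 0" if "p < N" for p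
    using assms[OF that] by (auto simp: folded_def)
  have supp: "{i. i < n \<and> c i \<noteq> 0} = ?A \<union> (\<lambda>p. p + N) ` ?A"
  proof (intro set_eqI iffI)
    fix i assume i: "i \<in> {i. i < n \<and> c i \<noteq> 0}"
    show "i \<in> ?A \<union> (\<lambda>p. p + N) ` ?A"
    proof (cases "i < N")
      case False
      then have "i - N < N" "i = (i - N) + N" using i by (auto simp: n_eq)
      moreover from this have "i - N \<in> ?A" using i shift[of "i - N"] by simp
      ultimately show ?thesis by blast
    qed (use i in auto)
  qed (use shift n_eq in auto)
  have "card (?A \<union> (\<lambda>p. p + N) ` ?A) = card ?A + card ((\<lambda>p. p + N) ` ?A)"
    by (intro card_Un_disjoint) auto
  then show "wt = 2 * card ?A"
    by (simp add: wt_def supp card_image)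
  show "\<exists>p<N. c p \<noteq> 0" using nonzero supp by blast
qed

section \<open>BCH bounds along even steps\<close>

lemma inj_on_even_step:
  assumes "s * v mod n = 2 \<or> (s * v + 2) mod n = 0"
  shows "inj_on (\<lambda>p. \<alpha> ^ (p * v)) {..<N}"
proof (rule inj_onI)
  fix p q assume pq: "p \<in> {..<N}" "q \<in> {..<N}" "\<alpha> ^ (p * v) = \<alpha> ^ (q * v)"
  have pow: "(\<alpha> ^ (s * v)) ^ p = (\<alpha> ^ (s * v)) ^ q"
  proof -
    have "(\<alpha> ^ (s * v)) ^ r = (\<alpha> ^ (r * v)) ^ s" for r by (simp add: mult_ac flip: power_mult)
    then show ?thesis using pq(3) by simp
  qed
  \<comment> \<open>Either \<alpha> squared or its inverse is a power of
    \<open>\<alpha> ^ v\<close>, and \<alpha> squared has order \<open>N\<close>.\<close>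
  have "(\<alpha> ^ 2) ^ p = (\<alpha> ^ 2) ^ q"
    using assms
  proof
    assume "s * v mod n = 2"
    then have "\<alpha> ^ (s * v) = \<alpha> ^ 2" using \<alpha>_power_mod[of "s * v"] by simp
    then show ?thesis using pow by simp
  next
    assume "(s * v + 2) mod n = 0"
    then have "\<alpha> ^ (s * v) * \<alpha> ^ 2 = 1"
      using \<alpha>_power_mod[of "s * v + 2"] by (simp only: power_add power_0)
    then have "\<alpha> ^ (s * v) = inverse (\<alpha> ^ 2)" by (simp add: field_simps)
    then show ?thesis using pow by (simp add: power_inverse)
  qed
  then have "2 * p mod n = 2 * q mod n" by (simp add: \<alpha>_power_eq_iff flip: power_mult)
  then show "p = q" using pq by (simp add: n_eq)
qed

lemma folded_weight_bound:
  assumes "inj_on (\<lambda>p. \<alpha> ^ (p * v)) {..<N}" "even v"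
    and "\<And>l. l < k \<Longrightarrow> spectrum c (l * v) = 0" and "p < N" "folded p \<noteq> 0"
  shows "k < card {p. p < N \<and> folded p \<noteq> 0}"
proof -
  have "(\<Sum>p<N. folded p * (\<alpha> ^ (p * v)) ^ l) = 0" if "l < k" for l
    using assms(3)[OF that] assms(2) by (simp add: spectrum_even mult_ac flip: power_mult)
  from Vandermonde_support_bound[OF _ assms(1) this, of k p] assms(4,5)
  show ?thesis by simp
qed

text \<open>As \<open>v\<close> is even, all exponents \<open>a + l * v\<close> are odd and see
  twice the first half; the factor \<open>\<alpha> ^ (p * a)\<close> is absorbed into the
  coefficients.\<close>

lemma half_weight_bound:
  assumes folded: "\<And>p. p < N \<Longrightarrow> folded p = 0"
    and "inj_on (\<lambda>p. \<alpha> ^ (p * v)) {..<N}" "even v" "odd a"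
    and zero: "\<And>l. l < k \<Longrightarrow> spectrum c (a + l * v) = 0"
  shows "k < card {p. p < N \<and> c p \<noteq> 0}"
proof -
  obtain p where p: "p < N" "c p \<noteq> 0" using wt_if_folded_zero(2)[OF folded] by blast
  have "(\<Sum>p<N. (c p * \<alpha> ^ (p * a)) * (\<alpha> ^ (p * v)) ^ l) = 0" if "l < k" for l
  proof -
    have "2 * (\<Sum>p<N. c p * \<alpha> ^ (p * (a + l * v))) = 0"
      using zero[OF that] assms(3,4) by (simp flip: spectrum_odd[OF folded])
    then show ?thesis
      using two_neq_0 by (simp add: algebra_simps power_add flip: power_mult)
  qed
  from Vandermonde_support_bound[OF _ assms(2) this, of k p] p
  show ?thesis by simp
qed

text \<open>For even \<open>e \<noteq> 0\<close> one of the weights of \<open>e\<close> and \<open>n - e\<close> is \<open>2\<close> modulo \<open>4\<close>, so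
  the folded word is orthogonal to itself.\<close>

lemma three_dvd_folded_weight: "3 dvd card {p. p < N \<and> folded p \<noteq> 0}"
proof -
  \<comment> \<open>Nonzero elements of the prime field have square 1, so the inner product of the
    folded word with itself is its weight modulo 3.\<close>
  have sq: "folded p * folded p = (if folded p \<noteq> 0 then 1 else 0)" if "p < N" for p
  proof -
    have "folded p \<in> F3"
      using c_F3 that by (simp add: folded_def n_eq F3_add three_eq_0)
    moreover have "(2::'a) * 2 = 3 + 1" by simp
    ultimately show ?thesis using three_eq_0 by (auto simp: F3_def)
  qed
  have "of_nat N * (\<Sum>p<N. folded p * folded p) = (\<Sum>j<N. spectrum c (2 * j) * spectrum c (n - 2 * j))"
    using Parseval[of N 2 folded folded] n_eq by (simp add: spectrum_even)
  also have "\<dots> = 0"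
  proof (intro sum.neutral ballI)
    fix j assume "j \<in> {..<N}"
    then have j: "2 * j < n" by (simp add: n_eq)
    have "spectrum c (2 * j) = 0 \<or> spectrum c (n - 2 * j) = 0"
    proof (cases "2 * j = 0 \<or> w3 (2 * j) mod 4 = 2")
      case True
      then show ?thesis using j spectrum_zero[of "2 * j"] by blast
    next
      case False
      moreover have "even (w3 (2 * j))" by (simp add: even_w3_iff)
      ultimately have "w3 (n - 2 * j) mod 4 = 2"
        using complementary_mod_4(1)[OF w3_minus[OF j] odd_m] by blast
      then show ?thesis using False spectrum_zero[of "n - 2 * j"] j by simp
    qed
    then show "spectrum c (2 * j) * spectrum c (n - 2 * j) = 0" by auto
  qed
  finally have "of_nat N * (\<Sum>p<N. folded p * folded p) = 0" .
  \<comment> \<open>In the field \<open>N + N = n = - 1\<close>.\<close>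
  moreover have "of_nat N \<noteq> (0::'a)" using of_nat_n by (auto simp: n_eq)
  moreover have "(\<Sum>p<N. folded p * folded p) = of_nat (card {p. p < N \<and> folded p \<noteq> 0})"
    by (simp add: sq flip: sum.inter_filter)
  ultimately show ?thesis by (simp add: of_nat_eq_0_iff_dvd)
qed

lemma wt_bound_folded:
  assumes "inj_on (\<lambda>p. \<alpha> ^ (p * v)) {..<N}" "even v" "1 \<le> h"
    and "\<And>l. l \<le> 3 ^ h \<Longrightarrow> spectrum c (l * v) = 0" and "p < N" "folded p \<noteq> 0"
  shows "3 ^ h + 3 \<le> wt"
proof -
  let ?k = "card {p. p < N \<and> folded p \<noteq> 0}"
  \<comment> \<open>Together with \<open>l = 0\<close> there are \<open>3 ^ h + 1\<close>
    zeros.\<close>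
  have "3 ^ h + 1 < ?k"
    using assms by (intro folded_weight_bound[of v _ p]) auto
  moreover have "3 dvd (3::nat) ^ h" using assms(3) by (simp add: dvd_power)
  then have "(3::nat) ^ h mod 3 = 0" by simp
  moreover have "?k mod 3 = 0" using three_dvd_folded_weight by simp
  ultimately have "3 ^ h + 3 \<le> ?k" by (rule add_3_le_if_mod_3)
  then show ?thesis using card_folded_le_wt by linarith
qed

section \<open>Weight bounds by the residue of \<open>m\<close> modulo 4\<close>

lemma step_inj_low:
  assumes "m = 2 * h + 1"
  shows "inj_on (\<lambda>p. \<alpha> ^ (p * (3 ^ h - 1))) {..<N}"
\<comment> \<open>The multiplier makes the product \<open>3 ^ m - 3 = n - 2\<close>.\<close>
proof (rule inj_on_even_step[of "3 * (3 ^ h + 1)"])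
  have "(1::nat) \<le> 3 ^ h" by simp
  then obtain x where x: "(3::nat) ^ h = Suc x" by (metis Suc_le_D One_nat_def)
  have "(3::nat) ^ m = 3 * (3 ^ h * 3 ^ h)" by (simp add: assms power_add mult_2)
  then have "3 * (3 ^ h + 1) * (3 ^ h - 1) + 2 = n" by (simp add: n_def x algebra_simps)
  then show "3 * (3 ^ h + 1) * (3 ^ h - 1) mod n = 2 \<or> (3 * (3 ^ h + 1) * (3 ^ h - 1) + 2) mod n = 0"
    by simp
qed

lemma step_inj_high:
  assumes "m = 2 * h + 1"
  shows "inj_on (\<lambda>p. \<alpha> ^ (p * (3 ^ Suc h - 1))) {..<N}"
\<comment> \<open>Here the product is \<open>3 ^ (2 * h + 2) - 1 = 3 * n + 2\<close>.\<close>
proof (rule inj_on_even_step[of "3 ^ Suc h + 1"])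
  have "(1::nat) \<le> 3 ^ h" by simp
  then obtain x where x: "(3::nat) ^ h = Suc x" by (metis Suc_le_D One_nat_def)
  have "(3::nat) ^ m = 3 * (3 ^ h * 3 ^ h)" by (simp add: assms power_add mult_2)
  then have "(3 ^ Suc h + 1) * (3 ^ Suc h - 1) = n * 3 + 2"
    by (simp add: n_def x algebra_simps)
  moreover have "(n * 3 + 2) mod n = 2"
    unfolding mod_mult_self4 using n_ge by simp
  ultimately show "(3 ^ Suc h + 1) * (3 ^ Suc h - 1) mod n = 2
      \<or> ((3 ^ Suc h + 1) * (3 ^ Suc h - 1) + 2) mod n = 0"
    by simp
qed

text \<open>For even \<open>h\<close>, modulo 4, \<open>2 * (h + 1)\<close> is 2 and
  \<open>2 * h + 1\<close> is 1. So step \<open>3 ^ Suc h - 1\<close> serves a nonzero folded word,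
  and step \<open>3 ^ h - 1\<close> the odd exponents.\<close>

lemma wt_bound_1_mod_4:
  assumes m: "m = 2 * h + 1" and "even h"
  shows "3 ^ h + 15 \<le> 2 * wt"
proof -
  have nh: "n = 3 ^ (2 * h + 1) - 1" using n_def by (simp only: m)
  have h: "2 \<le> h" using assms m_ge_3 by presburger
  have "(3::nat) ^ 2 \<le> 3 ^ h" using h by (intro power_increasing) auto
  then have h9: "(9::nat) \<le> 3 ^ h" by simp
  have pm: "(3::nat) ^ m = 3 ^ h * 3 ^ Suc h" "(3::nat) ^ m = 3 ^ h * 3 ^ h * 3"
    by (simp_all add: m power_add mult_2)
  show ?thesis
  proof (cases "\<exists>p<N. folded p \<noteq> 0")
    case True
    then obtain p where p: "p < N" "folded p \<noteq> 0" by blast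
    have "spectrum c (l * (3 ^ Suc h - 1)) = 0" if "l \<le> 3 ^ h" for l
    proof (rule spectrum_zero)
      have "l * (3 ^ Suc h - 1) \<le> 3 ^ h * (3 ^ Suc h - 1)" using that by (rule mult_le_mono1)
      also have "\<dots> < n"
      proof -
        have "3 ^ h * (3 ^ Suc h - 1) = 3 ^ m - (3::nat) ^ h" by (simp add: pm diff_mult_distrib2)
        moreover have "(3::nat) ^ h \<le> 3 ^ m" unfolding m by (intro power_increasing) auto
        ultimately show ?thesis using h9 unfolding n_def by linarith
      qed
      finally show "l * (3 ^ Suc h - 1) < n" .
      have "l \<le> 3 ^ Suc h" using that by simp
      show "l * (3 ^ Suc h - 1) = 0 \<or> w3 (l * (3 ^ Suc h - 1)) mod 4 = 1 \<or>
          w3 (l * (3 ^ Suc h - 1)) mod 4 = 2"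
      proof (cases "l = 0")
        case False
        moreover have "2 * Suc h mod 4 = 2" using \<open>even h\<close> by presburger
        ultimately show ?thesis
          using w3_mult_pred_power[of l "Suc h"] \<open>l \<le> 3 ^ Suc h\<close> by simp
      qed simp
    qed
    \<comment> \<open>Doubling \<open>3 ^ h + 3\<close> gives at least \<open>3 ^ h + 15\<close>
      because \<open>9 \<le> 3 ^ h\<close>.\<close>
    from wt_bound_folded[where h = h, OF step_inj_high[OF m] _ _ this p] h h9
    show ?thesis by simp
  next
    case False
    then have folded: "\<And>p. p < N \<Longrightarrow> folded p = 0" by blast
    \<comment> \<open>The top digit makes the exponents odd and adds 1 to their weight. One multiple
      of the step is included, so that the factor is \<open>Suc l\<close> and
      \<open>w3_mult_pred_power\<close> applies from \<open>l = 0\<close> on.\<close>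
    let ?a = "3 ^ (2 * h) + (3 ^ h - 1) :: nat"
    have "spectrum c (?a + l * (3 ^ h - 1)) = 0" if "l < 3 ^ h" for l
    proof (rule spectrum_zero)
      have "Suc l * (3 ^ h - 1) \<le> 3 ^ h * (3 ^ h - 1)" using that by (intro mult_le_mono1) simp
      also have "\<dots> < 3 ^ (2 * h)" by (simp add: diff_mult_distrib2 power_add mult_2)
      finally have lt: "Suc l * (3 ^ h - 1) < 3 ^ (2 * h)" .
      have eq: "?a + l * (3 ^ h - 1) = 1 * 3 ^ (2 * h) + Suc l * (3 ^ h - 1)"
        by (simp only: mult_Suc mult_1 add.assoc)
      show "?a + l * (3 ^ h - 1) < n"
        using lt unfolding eq nh by simp
      have "w3 (?a + l * (3 ^ h - 1)) = 1 + 2 * h"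
        unfolding eq w3_shift_add[OF lt] using that by (subst w3_mult_pred_power) auto
      moreover have "(1 + 2 * h) mod 4 = 1" using \<open>even h\<close> by presburger
      ultimately show "?a + l * (3 ^ h - 1) = 0 \<or> w3 (?a + l * (3 ^ h - 1)) mod 4 = 1 \<or>
          w3 (?a + l * (3 ^ h - 1)) mod 4 = 2"
        by simp
    qed
    from half_weight_bound[OF folded step_inj_low[OF m] _ _ this]
    have "3 ^ h < card {p. p < N \<and> c p \<noteq> 0}" by simp
    then show ?thesis using wt_if_folded_zero(1)[OF folded] h9 by linarith
  qed
qed

text \<open>Odd \<open>h\<close> exchanges the two steps. On odd exponents only
  \<open>3 ^ (h - 1)\<close> positive multiples of the larger step fit below the top digit.\<close>

lemma wt_bound_3_mod_4:
  assumes m: "m = 2 * h + 1" and "odd h" "3 \<le> h"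
  shows "3 ^ h + 13 \<le> 2 * wt"
proof -
  have nh: "n = 3 ^ (2 * h + 1) - 1" using n_def by (simp only: m)
  obtain g where g: "h = Suc g" "2 \<le> g" using \<open>3 \<le> h\<close> by (cases h) auto
  have "(3::nat) ^ 2 \<le> 3 ^ g" using g by (intro power_increasing) auto
  then have g9: "(9::nat) \<le> 3 ^ g" by simp
  have h3: "(3::nat) ^ h = 3 * 3 ^ g" by (simp add: g)
  show ?thesis
  proof (cases "\<exists>p<N. folded p \<noteq> 0")
    case True
    then obtain p where p: "p < N" "folded p \<noteq> 0" by blast
    have "spectrum c (l * (3 ^ h - 1)) = 0" if "l \<le> 3 ^ h" for l
    proof (rule spectrum_zero)
      have "l * (3 ^ h - 1) \<le> 3 ^ h * (3 ^ h - 1)" using that by (rule mult_le_mono1)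
      also have "\<dots> \<le> 3 ^ (2 * h)" by (simp add: power_add mult_2)
      also have "\<dots> < n"
      proof -
        have "(1::nat) \<le> 3 ^ (2 * h)" by simp
        then show ?thesis unfolding nh power_add power_one_right by linarith
      qed
      finally show "l * (3 ^ h - 1) < n" .
      show "l * (3 ^ h - 1) = 0 \<or> w3 (l * (3 ^ h - 1)) mod 4 = 1 \<or> w3 (l * (3 ^ h - 1)) mod 4 = 2"
      proof (cases "l = 0")
        case False
        moreover have "2 * h mod 4 = 2" using \<open>odd h\<close> by presburger
        ultimately show ?thesis
          using w3_mult_pred_power[of l h] that by simp
      qed simp
    qed
    from wt_bound_folded[where h = h, OF step_inj_low[OF m] _ _ this p] g9 h3 \<open>3 \<le> h\<close>
    show ?thesis by simp
  next
    case False
    then have folded: "\<And>p. p < N \<Longrightarrow> folded p = 0" by blast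
    let ?v = "3 ^ Suc h - 1 :: nat"
    let ?a = "3 ^ (2 * h) + ?v"
    have "spectrum c (?a + l * ?v) = 0" if "l < 3 ^ g" for l
    proof (rule spectrum_zero)
      have "Suc l * ?v \<le> 3 ^ g * ?v" using that by (intro mult_le_mono1) simp
      also have "\<dots> < 3 ^ g * 3 ^ Suc h" by (intro mult_strict_left_mono) simp_all
      also have "\<dots> = 3 ^ (2 * h)" by (simp add: power_add mult_2 g)
      finally have lt: "Suc l * ?v < 3 ^ (2 * h)" .
      have eq: "?a + l * ?v = 1 * 3 ^ (2 * h) + Suc l * ?v"
        by (simp only: mult_Suc mult_1 add.assoc)
      show "?a + l * ?v < n"
        using lt unfolding eq nh by simp
      have "Suc l \<le> 3 ^ Suc h" using that by (simp add: g)
      then have "w3 (?a + l * ?v) = 1 + 2 * Suc h"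
        unfolding eq w3_shift_add[OF lt] by (subst w3_mult_pred_power) auto
      moreover have "(1 + 2 * Suc h) mod 4 = 1" using \<open>odd h\<close> by presburger
      ultimately show "?a + l * ?v = 0 \<or> w3 (?a + l * ?v) mod 4 = 1 \<or> w3 (?a + l * ?v) mod 4 = 2"
        by simp
    qed
    from half_weight_bound[OF folded step_inj_high[OF m] _ _ this]
    have "3 ^ g < card {p. p < N \<and> c p \<noteq> 0}" by simp
    \<comment> \<open>The inequality \<open>4 * (3 ^ g + 1) \<ge> 3 * 3 ^ g + 13\<close> is exactly
      \<open>3 ^ g \<ge> 9\<close>, whence the hypothesis \<open>3 \<le> h\<close>.\<close>
    then show ?thesis using wt_if_folded_zero(1)[OF folded] g9 h3 by linarith
  qed
qed

text \<open>The generalised Newton identities for a locator polynomial of degree \<open>7\<close> are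
  inconsistent, although the BCH bound only gives weight \<open>7\<close>.\<close>

lemma wt_bound_m_3:
  assumes m: "m = 3"
  shows "8 \<le> wt"
proof (rule ccontr)
  assume "\<not> 8 \<le> wt"
  have n: "n = 26" using n_def m by simp
  then have "card {i. i < n \<and> c i \<noteq> 0} \<le> 7" "7 \<le> card {..<n}"
    using \<open>\<not> 8 \<le> wt\<close> by (simp_all add: wt_def)
  \<comment> \<open>The support is enlarged to exactly 7 positions, which fixes the degree of the
    locator polynomial.\<close>
  then obtain A where A: "{i. i < n \<and> c i \<noteq> 0} \<subseteq> A" "A \<subseteq> {..<n}" "card A = 7"
    using exists_subset_between[of "{i. i < n \<and> c i \<noteq> 0}" 7 "{..<n}"] by auto
  have finA: "finite A" using A(2) finite_subset by blast
  define \<sigma> where "\<sigma> = (\<Prod>i\<in>A. [:- (\<alpha> ^ i), 1:])"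
  have deg: "degree \<sigma> = 7" by (simp add: \<sigma>_def degree_prod_eq_sum_degree A)
  have s7: "coeff \<sigma> 7 = 1"
    using lead_coeff_prod[of "\<lambda>i. [:- (\<alpha> ^ i), 1:]" A] deg by (simp add: \<sigma>_def)
  have s0: "coeff \<sigma> 0 \<noteq> 0"
    using finA by (simp add: \<sigma>_def poly_prod flip: poly_0_coeff_0)
  define S where "S = spectrum c"
  \<comment> \<open>The sum evaluates the locator at each \<open>\<alpha> ^ i\<close>, where it
    vanishes on the support.\<close>
  have newton: "(\<Sum>k\<le>7. coeff \<sigma> k * S (j + k)) = 0" for j
  proof -
    have "(\<Sum>k\<le>7. coeff \<sigma> k * S (j + k)) = (\<Sum>i<n. c i * \<alpha> ^ (i * j) * poly \<sigma> (\<alpha> ^ i))"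
      unfolding S_def spectrum_def poly_altdef deg sum_distrib_left
      by (subst sum.swap) (intro sum.cong refl, simp add: algebra_simps power_add flip: power_mult)
    also have "\<dots> = 0"
    proof (intro sum.neutral ballI)
      fix i assume "i \<in> {..<n}"
      then have "c i = 0 \<or> i \<in> A" using A(1) by blast
      then show "c i * \<alpha> ^ (i * j) * poly \<sigma> (\<alpha> ^ i) = 0"
        using finA by (auto simp: \<sigma>_def poly_prod)
    qed
    finally show ?thesis .
  qed
  \<comment> \<open>Besides 0, these exponents have weight 1, 2 or 5.\<close>
  have Z: "S 0 = 0" "S 1 = 0" "S 2 = 0" "S 3 = 0" "S 4 = 0" "S 6 = 0" "S 9 = 0" "S 10 = 0"
    "S 23 = 0" "S 25 = 0"
    unfolding S_def by (rule spectrum_zero; simp add: n w3.simps)+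
  have Z': "S (Suc 0) = 0" "S (Suc (Suc 0)) = 0" "S (Suc (Suc (Suc 0))) = 0"
    using Z(2-4) by (simp_all add: numeral_2_eq_2 numeral_3_eq_3)
  have per: "S (26 + e) = S e" for e
    unfolding S_def using spectrum_mod[of c "26 + e"] spectrum_mod[of c e] by (simp add: n)
  have P: "S 26 = 0" "S 27 = 0" "S 28 = 0" "S 29 = 0" "S 30 = 0" "S 31 = S 5" "S 32 = 0"
    using per[of 0] per[of 1] per[of 2] per[of 3] per[of 4] per[of 5] per[of 6] Z by simp_all
  \<comment> \<open>Frobenius conjugates: 21 is \<open>3 * 7\<close>, 24 is \<open>3 * 8\<close>,
    and 11 is \<open>9 * 7\<close> modulo 26.\<close>
  have F: "S 21 = S 7 ^ 3" "S 24 = S 8 ^ 3" "S 11 = S 7 ^ 9"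
    using spectrum_power[of c 1 7] spectrum_power[of c 1 8] spectrum_power[of c 2 7] c_F3
      spectrum_mod[of c 63] spectrum_mod[of c 11]
    by (simp_all add: S_def n)
  \<comment> \<open>Up to index 11 the only other value of \<open>S\<close> not known to vanish is
    \<open>S 11 = b ^ 9\<close>.\<close>
  define a b e where "a = S 5" and "b = S 7" and "e = S 8"
  define s where "s = coeff \<sigma>"
  \<comment> \<open>Otherwise 0 to 6 would be seven consecutive zeros, forcing weight at least
    8.\<close>
  have a: "a \<noteq> 0"
  proof
    assume "a = 0"
    have "S l = 0" if "l < 7" for l
    proof -
      have "l \<in> {0,1,2,3,4,5,6}" using that by auto
      then show ?thesis using Z \<open>a = 0\<close> by (auto simp: a_def)
    qed
    then have "(\<Sum>i\<in>{..<n}. c i * (\<alpha> ^ i) ^ l) = 0" if "l < 7" for l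
      using that by (simp add: S_def spectrum_def flip: power_mult)
    moreover obtain i where "i < n" "c i \<noteq> 0" using nonzero by blast
    ultimately have "7 < card {i \<in> {..<n}. c i \<noteq> 0}"
      using Vandermonde_support_bound[OF _ \<alpha>_inj, of 7 c i] by simp
    then show False using \<open>\<not> 8 \<le> wt\<close> by (simp add: wt_def)
  qed
  note N = newton[unfolded sum_atMost_7, folded s_def]
  have s7': "s 7 = 1" using s7 by (simp add: s_def)
  \<comment> \<open>The indices are chosen so that few unknown values enter; \<open>S 22\<close> in
    \<open>N21\<close> disappears once \<open>s 1 = 0\<close>.\<close>
  have N25: "s 6 * a = 0" using N[of 25] by (simp add: Z P a_def)
  have N24: "s 0 * e ^ 3 + a = 0" using N[of 24] by (simp add: Z P F a_def e_def s7')
  have N23: "s 1 * e ^ 3 = 0" using N[of 23] by (simp add: Z P F e_def)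
  have N21: "s 0 * b ^ 3 + s 1 * S 22 + s 3 * e ^ 3 = 0"
    using N[of 21] by (simp add: Z P F b_def e_def)
  have N0: "s 5 * a + b = 0" using N[of 0] by (simp add: Z Z' a_def b_def s7')
  have N1: "s 4 * a + s 6 * b + e = 0" using N[of 1] by (simp add: Z Z' a_def b_def e_def s7')
  have N2: "s 3 * a + s 5 * b + s 6 * e = 0" using N[of 2] by (simp add: Z Z' a_def b_def e_def)
  have N4: "s 1 * a + s 3 * b + s 4 * e + b ^ 9 = 0"
    using N[of 4] by (simp add: Z F a_def b_def e_def s7')
  have e: "e \<noteq> 0" using N24 a by auto
  have z: "s 6 = 0" "s 1 = 0" using N25 N23 a e by auto
  have e1: "s 3 * e ^ 6 = a * b ^ 3" using N21 N24 z by algebra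
  have e2: "s 5 * a = - b" "s 4 * a = - e" using N0 N1 z by (auto simp: eq_neg_iff_add_eq_0)
  have e3: "s 3 * a ^ 2 = b ^ 2" using N2 e2 z by algebra
  have b: "b \<noteq> 0"
  proof
    assume "b = 0"
    then have "s 4 * e = 0" using N4 z by simp
    then show False using e e2 by auto
  qed
  \<comment> \<open>Eliminate \<open>s 3\<close> from \<open>e1\<close> and
    \<open>e3\<close>.\<close>
  have "b ^ 2 * (a ^ 3 * b) = b ^ 2 * e ^ 6" using e1 e3 by algebra
  then have e4: "a ^ 3 * b = e ^ 6" using b by simp
  have pow: "a ^ 27 = a" "e ^ 54 = e ^ 2"
  proof -
    have 26: "a ^ 26 = 1" "e ^ 26 = 1" using power_n_eq_1 a e n by metis+
    have "a ^ 27 = a ^ 26 * a" "e ^ 54 = (e ^ 26) ^ 2 * e ^ 2"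
      by (simp_all flip: power_Suc2 power_mult power_add)
    then show "a ^ 27 = a" "e ^ 54 = e ^ 2" by (simp_all add: 26)
  qed
  \<comment> \<open>The ninth power produces the \<open>b ^ 9\<close> of \<open>N4\<close>, while
    the other exponents reduce modulo 26.\<close>
  have "(a ^ 3 * b) ^ 9 = (e ^ 6) ^ 9" by (simp add: e4)
  then have "a ^ 27 * b ^ 9 = e ^ 54" by (simp add: power_mult_distrib flip: power_mult)
  then have e5: "a * b ^ 9 = e ^ 2" by (simp add: pow)
  \<comment> \<open>In \<open>N4\<close> times \<open>a ^ 2\<close>, the two terms
    \<open>a * e ^ 2\<close> cancel and only \<open>b ^ 3\<close> survives.\<close>
  have "0 = a ^ 2 * (s 3 * b + s 4 * e + b ^ 9)" using N4 z by simp
  also have "\<dots> = (s 3 * a ^ 2) * b + (s 4 * a) * (a * e) + a * (a * b ^ 9)"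
    by (simp add: algebra_simps power2_eq_square)
  also have "\<dots> = b ^ 3"
    unfolding e2 e3 e5 by (simp add: power2_eq_square power3_eq_cube)
  finally have "b ^ 3 = 0" by simp
  then show False using b by simp
qed

end

section \<open>Parameters of the dual code\<close>

theorem theorem10:
  fixes m :: nat and \<alpha> :: "'a::field"
  assumes "card (UNIV :: 'a set) = 3 ^ m"
    and "m \<ge> 3" and "odd m"
    and "primitive_elem \<alpha>"
  defines "n \<equiv> 3 ^ m - 1"
    and "D \<equiv> dual_code (3 ^ m - 1) (code_C 2 3 m \<alpha>)"
  shows "(m mod 4 = 1 \<longrightarrow>
            real (min_dist D) \<ge> (3 ^ ((m - 1) div 2) + 15) / 2
          \<and> real (code_dim D) = (real n - 2) / 2)
       \<and> (m mod 4 = 3 \<longrightarrow>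
            real (min_dist D) \<ge> (3 ^ ((m - 1) div 2) + 13) / 2
          \<and> real (code_dim D) = real n / 2)"
proof -
  interpret F: ternary_field m \<alpha>
    using assms by unfold_locales auto
  have n: "n = F.n" by (simp add: n_def F.n_def)
  have D: "D = dual_code F.n (code_C 2 3 m \<alpha>)" by (simp add: D_def F.n_def)
  define h where "h = (m - 1) div 2"
  have mh: "m = 2 * h + 1" using \<open>odd m\<close> by (auto simp: h_def elim: oddE)
  let ?T = "T_set 2 3 m"
  have T: "real (2 * card ?T) = real n + real_of_int (half_sign m) - 1"
  proof -
    have "int (2 * card ?T) = int n + half_sign m - 1"
      using card_T_set_23[OF \<open>odd m\<close>] by (simp add: n_def of_nat_diff)
    then show ?thesis by linarith
  qed
  have "half_sign m \<ge> - 1" by (simp add: half_sign_def)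
  then have "card ?T > 0" using T F.n_ge n by linarith
  have card_D: "card D = 3 ^ card ?T" unfolding D by (rule F.card_dual_code_C)
  have dim: "code_dim D = card ?T"
    unfolding code_dim_def card_D by (rule the_equality) auto
  have fin: "finite D"
    using card_D by (metis card.infinite power_not_zero zero_neq_numeral)
  \<comment> \<open>Positive dimension yields two distinct words, so the minimum is taken over a
    nonempty set and is attained.\<close>
  have "\<exists>x\<in>D. \<exists>y\<in>D. x \<noteq> y"
  proof (rule ccontr)
    assume "\<not> ?thesis"
    then have "card D \<le> 1" using fin by (auto simp: card_le_Suc0_iff_eq)
    moreover have "(3::nat) ^ 1 \<le> 3 ^ card ?T" using \<open>card ?T > 0\<close> by (intro power_increasing) auto
    ultimately show False using card_D by simp
  qed
  moreover define H where "H = {hamming_dist x y | x y. x \<in> D \<and> y \<in> D \<and> x \<noteq> y}"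
  ultimately have "H \<noteq> {}" by blast
  moreover have "finite H"
  proof (rule finite_subset)
    show "H \<subseteq> (\<lambda>(x, y). hamming_dist x y) ` (D \<times> D)" by (auto simp: H_def)
  qed (use fin in auto)
  ultimately have "min_dist D \<in> H" unfolding min_dist_def H_def by (rule Min_in[rotated])
  then obtain x y where xy: "x \<in> D" "y \<in> D" "x \<noteq> y" "min_dist D = hamming_dist x y"
    by (auto simp: H_def)
  have words: "x \<in> words F.n" "y \<in> words F.n"
    using xy by (auto simp: D F.dual_code_C_iff)
  then have len: "length x = F.n" "length y = F.n" by (auto simp: words_def)
  have zero: "F.spectrum ((!) v) e = 0"
    if v: "v \<in> D" and e: "e < F.n" "e = 0 \<or> w3 e mod 4 = 1 \<or> w3 e mod 4 = 2" for v e
  proof (cases "e = 0")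
    case True
    \<comment> \<open>The spectrum at 0 equals that at \<open>n\<close>, the condition for
      \<open>j = 0\<close>.\<close>
    have "0 < F.n" "0 \<notin> ?T" using F.n_ge by (auto simp: F.T_set_iff)
    then have "F.spectrum ((!) v) (F.n - 0) = 0"
      using v unfolding D F.dual_code_C_iff by blast
    then show ?thesis using F.spectrum_mod[of "(!) v" F.n] True by simp
  next
    case False
    have "F.n - e \<notin> T_set 2 3 m"
      using complementary_mod_4(2)[OF F.w3_minus[OF e(1)] \<open>odd m\<close>] e(2) False
      unfolding F.T_set_iff by blast
    then have "F.spectrum ((!) v) (F.n - (F.n - e)) = 0"
      using v e(1) False unfolding D F.dual_code_C_iff
      by (metis diff_less neq0_conv order_less_trans)
    then show ?thesis using e by simp
  qed
  \<comment> \<open>The weight of the difference of a closest pair is the minimum distance.\<close>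
  interpret W: ternary_word m \<alpha> "\<lambda>i. x ! i - y ! i"
  proof unfold_locales
    show "odd m" by fact
    show "x ! i - y ! i \<in> F3" if "i < F.n" for i
      using that words by (intro F3_diff F.three_eq_0) (auto simp: words_def)
    show "F.spectrum (\<lambda>i. x ! i - y ! i) e = 0"
      if "e < F.n" "e = 0 \<or> w3 e mod 4 = 1 \<or> w3 e mod 4 = 2" for e
    proof -
      have "F.spectrum (\<lambda>i. x ! i - y ! i) e = F.spectrum ((!) x) e - F.spectrum ((!) y) e"
        by (simp add: F.spectrum_def left_diff_distrib sum_subtractf)
      then show ?thesis using zero that xy by simp
    qed
    show "\<exists>i<F.n. x ! i - y ! i \<noteq> 0"
      using xy(3) len by (metis eq_iff_diff_eq_0 nth_equalityI)
  qed
  have wt: "min_dist D = W.wt"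
    by (simp add: xy hamming_dist_def W.wt_def len)
  show ?thesis
  proof (intro conjI impI)
    assume m1: "m mod 4 = 1"
    then have "3 ^ h + 15 \<le> 2 * W.wt" using mh by (intro W.wt_bound_1_mod_4) presburger+
    then have "real (3 ^ h + 15) \<le> real (2 * W.wt)" by (rule of_nat_mono)
    then show "real (min_dist D) \<ge> (3 ^ ((m - 1) div 2) + 15) / 2"
      by (simp add: wt h_def)
    show "real (code_dim D) = (real n - 2) / 2"
      using T m1 by (simp add: dim half_sign_def)
  next
    assume m3: "m mod 4 = 3"
    then have "odd h" using mh by presburger
    have "3 ^ h + 13 \<le> 2 * W.wt"
    proof (cases "3 \<le> h")
      case True
      then show ?thesis using mh \<open>odd h\<close> by (intro W.wt_bound_3_mod_4)
    next
      \<comment> \<open>Only \<open>m = 3\<close> remains, where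
        \<open>3 ^ 1 + 13 = 2 * 8\<close>.\<close>
      case False
      then have "h = 1" using \<open>odd h\<close> by presburger
      then show ?thesis using W.wt_bound_m_3 mh by simp
    qed
    then have "real (3 ^ h + 13) \<le> real (2 * W.wt)" by (rule of_nat_mono)
    then show "real (min_dist D) \<ge> (3 ^ ((m - 1) div 2) + 13) / 2"
      by (simp add: wt h_def)
    show "real (code_dim D) = real n / 2"
      using T m3 by (simp add: dim half_sign_def)
  qed
qed

end
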